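(* For every simple digraph $\Gamma$, $\operatorname{th}(\Gamma)=\operatorname{th}(\Gamma^T)$.
   Context: A simple digraph $\Gamma$ has a finite vertex set and no loops or parallel arcs (opposite arcs allowed). The transpose $\Gamma^T$ is obtained by reversing every arc. $v$ is an out-neighbor of $u$ if $(u,v)\in E(\Gamma)$. Zero forcing: vertices are blue or white; a blue vertex $u$ with exactly one white out-neighbor $w$ may force $w$ ($u\to w$), turning it blue. A set $\mathcal F$ of forces is a set of forces of $B\subseteq V(\Gamma)$ if, starting with exactly $B$ blue, the forces in $\mathcal F$ can be validly performed in some order after which no further force is possible. Put $\mathcal F^{[0]}=B$ and $\mathcal F^{[t+1]}=\mathcal F^{[t]}\cup\{w\notin\mathcal F^{[t]}:(u\to w)\in\mathcal F,\ u\in\mathcal F^{[t]},\ w$ the only out-neighbor of $u$ outside $\mathcal F^{[t]}\}$; $\operatorname{pt}(\Gamma;\mathcal F)$ is the least $t$ with $\mathcal F^{[t]}=V(\Gamma)$ ($\infty$ if none); $\operatorname{pt}(\Gamma;B)=\min_{\mathcal F}\operatorname{pt}(\Gamma;\mathcal F)$. The throttling number is $\operatorname{th}(\Gamma)=\min_{B\subseteq V(\Gamma)}(|B|+\operatorname{pt}(\Gamma;B))$. *)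

theory Defs
  imports "Graph_Theory.Pair_Digraph" "HOL-Library.Extended_Nat"
begin

definition digraph_transpose :: "'a pair_pre_digraph \<Rightarrow> 'a pair_pre_digraph" where
  "digraph_transpose G = \<lparr>pverts = pverts G, parcs = (parcs G)\<inverse>\<rparr>"

definition out_neighbors :: "'a pair_pre_digraph \<Rightarrow> 'a \<Rightarrow> 'a set" where
  "out_neighbors G u = {v. (u, v) \<in> parcs G}"

text \<open>Throughout, \<open>S\<close> is the set of blue vertices, and a pair \<open>(u, w)\<close> stands for the
  force \<open>u \<rightarrow> w\<close>.\<close>

definition can_force :: "'a pair_pre_digraph \<Rightarrow> 'a set \<Rightarrow> 'a \<Rightarrow> 'a \<Rightarrow> bool" where
  "can_force G S u w \<longleftrightarrow> u \<in> S \<and> out_neighbors G u - S = {w}"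

fun valid_forces :: "'a pair_pre_digraph \<Rightarrow> 'a set \<Rightarrow> ('a \<times> 'a) list \<Rightarrow> bool" where
  "valid_forces G S [] \<longleftrightarrow> True"
| "valid_forces G S ((u, w) # fs) \<longleftrightarrow> can_force G S u w \<and> valid_forces G (insert w S) fs"

definition is_set_of_forces :: "'a pair_pre_digraph \<Rightarrow> 'a set \<Rightarrow> ('a \<times> 'a) set \<Rightarrow> bool" where
  "is_set_of_forces G B F \<longleftrightarrow>
     (\<exists>fs. set fs = F \<and> valid_forces G B fs \<and> (\<nexists>u w. can_force G (B \<union> snd ` F) u w))"

fun blue_at :: "'a pair_pre_digraph \<Rightarrow> 'a set \<Rightarrow> ('a \<times> 'a) set \<Rightarrow> nat \<Rightarrow> 'a set" where
  "blue_at G B F 0 = B"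
| "blue_at G B F (Suc t) =
     blue_at G B F t \<union> {w. w \<notin> blue_at G B F t \<and> (\<exists>u. (u, w) \<in> F \<and> can_force G (blue_at G B F t) u w)}"

definition pt_forces :: "'a pair_pre_digraph \<Rightarrow> 'a set \<Rightarrow> ('a \<times> 'a) set \<Rightarrow> enat" where
  "pt_forces G B F =
     (if \<exists>t. blue_at G B F t = pverts G then enat (LEAST t. blue_at G B F t = pverts G) else \<infinity>)"

text \<open>The order on \<^typ>\<open>enat\<close> is a well-order, so infima of nonempty families are minima;
  see \<open>pt_set_attained\<close> and \<open>throttling_number_attained\<close>.\<close>

definition pt_set :: "'a pair_pre_digraph \<Rightarrow> 'a set \<Rightarrow> enat" where
  "pt_set G B = (INF F \<in> {F. is_set_of_forces G B F}. pt_forces G B F)"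

definition throttling_number :: "'a pair_pre_digraph \<Rightarrow> enat" where
  "throttling_number G = (INF B \<in> {B. B \<subseteq> pverts G}. enat (card B) + pt_set G B)"

lemma set_of_forces_exists:
  assumes "pair_digraph G" "B \<subseteq> pverts G"
  shows "\<exists>F. is_set_of_forces G B F"
proof -
  interpret pair_digraph G by fact
  have "\<exists>fs. valid_forces G S fs \<and> (\<nexists>u w. can_force G (S \<union> snd ` set fs) u w)"
    if "S \<subseteq> pverts G" for S
    using that
  proof (induction "card (pverts G - S)" arbitrary: S rule: less_induct)
    case less
    show ?case
    proof (cases "\<exists>u w. can_force G S u w")
      case True
      then obtain u w where uw: "can_force G S u w" by blast
      then have "w \<in> out_neighbors G u" "w \<notin> S"
        unfolding can_force_def by blast+
      then have w: "w \<in> pverts G - S"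
        unfolding out_neighbors_def using wellformed' by blast
      then have "pverts G - insert w S \<subset> pverts G - S" by blast
      then have "card (pverts G - insert w S) < card (pverts G - S)"
        by (intro psubset_card_mono) (use pair_finite_verts in auto)
      from less.hyps[OF this] less.prems w obtain fs where "valid_forces G (insert w S) fs"
        "\<nexists>u w'. can_force G (insert w S \<union> snd ` set fs) u w'"
        by auto
      with uw show ?thesis by (intro exI[of _ "(u, w) # fs"]) simp
    next
      case False
      then show ?thesis by (intro exI[of _ "[]"]) simp
    qed
  qed
  from this[OF assms(2)] obtain fs where
    "valid_forces G B fs" "\<nexists>u w. can_force G (B \<union> snd ` set fs) u w" by (elim exE conjE)
  then have "is_set_of_forces G B (set fs)"
    unfolding is_set_of_forces_def by (intro exI[of _ fs] conjI refl)
  then show ?thesis ..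
qed

lemma pt_set_attained:
  assumes "pair_digraph G" "B \<subseteq> pverts G"
  shows "\<exists>F. is_set_of_forces G B F \<and> pt_set G B = pt_forces G B F"
proof -
  obtain F where "is_set_of_forces G B F" using set_of_forces_exists[OF assms] by blast
  then have "pt_forces G B F \<in> pt_forces G B ` {F. is_set_of_forces G B F}" by simp
  then have "pt_set G B \<in> pt_forces G B ` {F. is_set_of_forces G B F}"
    unfolding pt_set_def by (rule wellorder_InfI)
  then show ?thesis by blast
qed

lemma throttling_number_attained:
  "\<exists>B \<subseteq> pverts G. throttling_number G = enat (card B) + pt_set G B"
proof -
  have "throttling_number G \<in> (\<lambda>B. enat (card B) + pt_set G B) ` {B. B \<subseteq> pverts G}"
    unfolding throttling_number_def
    by (rule wellorder_InfI[of "enat (card {}) + pt_set G {}"], rule image_eqI[of _ _ "{}"]) simp_all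
  then show ?thesis by blast
qed

end

theory Submission
  imports Defs
begin

text \<open>Reversing every force of a set \<open>F\<close> of forces that turns all vertices blue gives a set of
  forces of the transpose, started from the set \<open>terminus\<close> of the vertices that perform no
  force. Every vertex forces at most once and is forced at most once, so the terminus has as many
  vertices as the initial set. If \<open>F\<close> needs \<open>t\<close> steps, then after \<open>s\<close> steps the
  reversed process has coloured every vertex except possibly those whose force took place within
  the first \<open>t - s\<close> steps, hence it needs at most \<open>t\<close> steps. As transposition is
  an involution, the resulting inequality of throttling numbers is an equality.\<close>

definition terminus :: "'a pair_pre_digraph \<Rightarrow> ('a \<times> 'a) set \<Rightarrow> 'a set" where
  "terminus G F = pverts G - fst ` F"

section \<open>Transposed digraphs\<close>

lemma pverts_transpose [simp]: "pverts (digraph_transpose G) = pverts G"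
  by (simp add: digraph_transpose_def)

lemma out_neighbors_transpose: "out_neighbors (digraph_transpose G) w = {u. w \<in> out_neighbors G u}"
  by (simp add: digraph_transpose_def out_neighbors_def)

lemma transpose_transpose [simp]: "digraph_transpose (digraph_transpose G) = G"
  by (simp add: digraph_transpose_def)

lemma pair_digraph_transpose:
  assumes "pair_digraph G"
  shows "pair_digraph (digraph_transpose G)"
proof -
  interpret pair_digraph G by fact
  show ?thesis
    using arc_fst_in_verts arc_snd_in_verts pair_no_loops pair_finite_verts pair_finite_arcs
    by unfold_locales (fastforce simp: digraph_transpose_def)+
qed

section \<open>Chronological lists of forces\<close>

lemma can_forceD:
  assumes "can_force G S u w"
  shows "u \<in> S" "w \<notin> S" "w \<in> out_neighbors G u"
  using assms unfolding can_force_def by blast+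

lemma can_force_in_pverts:
  assumes "pair_digraph G" "can_force G S u w"
  shows "w \<in> pverts G" "u \<in> pverts G"
proof -
  interpret pair_digraph G by fact
  have "(u, w) \<in> parcs G" using assms(2) by (auto simp: can_force_def out_neighbors_def)
  then show "w \<in> pverts G" "u \<in> pverts G" using wellformed' by auto
qed

lemma valid_forces_append:
  "valid_forces G S (xs @ ys) \<longleftrightarrow> valid_forces G S xs \<and> valid_forces G (S \<union> snd ` set xs) ys"
  by (induction G S xs rule: valid_forces.induct) auto

text \<open>Replaces the recursion by a condition at each position, so that a reversed list can be
  checked one force at a time against the original list.\<close>

lemma valid_forcesI:
  assumes "\<And>xs u w ys. fs = xs @ (u, w) # ys \<Longrightarrow> can_force G (S \<union> snd ` set xs) u w"
  shows "valid_forces G S fs"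
  using assms
proof (induction fs rule: rev_induct)
  case (snoc f fs)
  obtain u w where f: "f = (u, w)" by (cases f)
  have "valid_forces G S fs"
  proof (rule snoc.IH)
    fix xs u' w' ys assume "fs = xs @ (u', w') # ys"
    then show "can_force G (S \<union> snd ` set xs) u' w'"
      using snoc.prems[of xs u' w' "ys @ [f]"] by simp
  qed
  then show ?case using snoc.prems[of fs u w "[]"] by (simp add: f valid_forces_append)
qed simp

lemma valid_forces_splitD:
  "valid_forces G S (xs @ (u, w) # ys) \<Longrightarrow> can_force G (S \<union> snd ` set xs) u w"
  by (simp add: valid_forces_append)

text \<open>When \<open>u\<close> forces, its target is its last white out-neighbor, and blue
  vertices stay blue.\<close>

lemma valid_forces_out_neighbors:
  assumes "valid_forces G S fs" "u \<in> fst ` set fs"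
  shows "out_neighbors G u \<subseteq> S \<union> snd ` set fs"
proof -
  obtain w where "(u, w) \<in> set fs" using assms(2) by auto
  then obtain xs ys where fs: "fs = xs @ (u, w) # ys" by (meson split_list)
  from valid_forces_splitD[of G S xs u w ys] assms(1) show ?thesis
    by (auto simp: fs can_force_def)
qed

lemma valid_forces_fst:
  assumes "valid_forces G S fs"
  shows "fst ` set fs \<subseteq> S \<union> snd ` set fs"
proof
  fix u assume "u \<in> fst ` set fs"
  then obtain w where "(u, w) \<in> set fs" by auto
  then obtain xs ys where fs: "fs = xs @ (u, w) # ys" by (meson split_list)
  from valid_forces_splitD[of G S xs u w ys] assms show "u \<in> S \<union> snd ` set fs"
    by (auto simp: fs can_force_def)
qed

text \<open>A vertex that has forced has no white out-neighbor left, so it cannot force again; a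
  target is white when forced, so it is neither initial nor an earlier target.\<close>

lemma valid_forces_distinct:
  assumes "valid_forces G S fs"
  shows "distinct (map fst fs)" "distinct (map snd fs)" "S \<inter> snd ` set fs = {}"
  using assms
proof (induction fs rule: rev_induct)
  case (snoc f fs)
  obtain u w where f: "f = (u, w)" by (cases f)
  {
    case 1
    then have v: "valid_forces G S fs" and c: "can_force G (S \<union> snd ` set fs) u w"
      by (auto simp: f valid_forces_append)
    have "u \<notin> fst ` set fs"
      using valid_forces_out_neighbors[OF v, of u] can_forceD(2,3)[OF c] by blast
    then show ?case using snoc.IH(1)[OF v] by (simp add: f)
  next
    case 2
    then show ?case using snoc.IH(2) by (auto simp: f valid_forces_append can_force_def)
  next
    case 3
    then show ?case using snoc.IH(3) by (auto simp: f valid_forces_append can_force_def)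
  }
qed simp_all

section \<open>Stages of propagation\<close>

lemma blue_at_subset: "blue_at G B F t \<subseteq> B \<union> snd ` F"
  by (induction t) force+

lemma blue_at_mono: "s \<le> t \<Longrightarrow> blue_at G B F s \<subseteq> blue_at G B F t"
  by (rule lift_Suc_mono_le) auto

lemma blue_at_forced:
  assumes "w \<in> blue_at G B F t" "w \<notin> B"
  shows "\<exists>s u. s < t \<and> (u, w) \<in> F \<and> can_force G (blue_at G B F s) u w"
  using assms(1)
proof (induction t)
  case (Suc t)
  show ?case
  proof (cases "w \<in> blue_at G B F t")
    case True
    then show ?thesis using Suc.IH less_SucI by blast
  next
    case False
    then show ?thesis using Suc.prems by auto
  qed
qed (use assms(2) in simp)

text \<open>The forces form a list because reversing them needs a chronological order; propagation
  only uses \<open>set fs\<close>.\<close>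

locale forcing_process =
  fixes G :: "'a pair_pre_digraph" and B :: "'a set" and fs :: "('a \<times> 'a) list"
  assumes pair_digraph: "pair_digraph G"
    and initial_subset: "B \<subseteq> pverts G"
    and valid: "valid_forces G B fs"
    and covers: "pverts G \<subseteq> B \<union> snd ` set fs"
begin

section \<open>Reversal of a process that turns every vertex blue\<close>

lemma finite_pverts: "finite (pverts G)"
proof -
  interpret pair_digraph G by (rule pair_digraph)
  show ?thesis by simp
qed

lemma force_in_pverts:
  assumes "(u, w) \<in> set fs"
  shows "u \<in> pverts G" "w \<in> pverts G"
proof -
  obtain xs ys where fs: "fs = xs @ (u, w) # ys" using assms by (meson split_list)
  show "u \<in> pverts G" "w \<in> pverts G"
    using can_force_in_pverts[OF pair_digraph valid_forces_splitD[OF valid[unfolded fs]]] by auto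
qed

lemma forces_injective:
  assumes "(u, w) \<in> set fs" "(u', w') \<in> set fs"
  shows "u = u' \<longleftrightarrow> w = w'"
  using valid_forces_distinct(1,2)[OF valid] assms
  by (metis distinct_map inj_on_contraD fst_conv snd_conv)

lemma forced_not_initial: "(u, w) \<in> set fs \<Longrightarrow> w \<notin> B"
  using valid_forces_distinct(3)[OF valid] by force

text \<open>\<open>B\<close> is the complement of the targets and the terminus that of the sources;
  there are \<open>length fs\<close> of each.\<close>

lemma card_terminus: "card (terminus G (set fs)) = card B"
proof -
  have V: "pverts G = B \<union> snd ` set fs"
    using covers initial_subset force_in_pverts by auto
  have "card (pverts G) = card B + card (snd ` set fs)"
    unfolding V using valid_forces_distinct(3)[OF valid] finite_pverts initial_subset
    by (intro card_Un_disjoint) (auto intro: finite_subset)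
  moreover have "card (snd ` set fs) = length fs" "card (fst ` set fs) = length fs"
    using valid_forces_distinct[OF valid] by (metis distinct_card length_map set_map)+
  moreover have "card (terminus G (set fs)) = card (pverts G) - card (fst ` set fs)"
    unfolding terminus_def using force_in_pverts by (intro card_Diff_subset) auto
  ultimately show ?thesis by simp
qed

text \<open>A source of a force before \<open>(u, w)\<close> cannot have \<open>w\<close> as an
  out-neighbor, since \<open>w\<close> was still white after that force. So \<open>u\<close> is the
  only white in-neighbor of \<open>w\<close> when the reversed force is due.\<close>

lemma reversed_valid:
  "valid_forces (digraph_transpose G) (terminus G (set fs)) (rev (map prod.swap fs))"
proof (rule valid_forcesI)
  fix xs w u ys
  assume "rev (map prod.swap fs) = xs @ (w, u) # ys"
  then have "map prod.swap fs = rev (xs @ (w, u) # ys)"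
    by (metis rev_rev_ident)
  then have "fs = map prod.swap (rev (xs @ (w, u) # ys))"
    by (metis list.map_id map_map swap_comp_swap)
  then obtain ps qs where fs: "fs = ps @ (u, w) # qs" and qs: "snd ` set xs = fst ` set qs"
    by (rule_tac that[of "map prod.swap (rev ys)" "map prod.swap (rev xs)"]) (auto simp: image_image)
  have vp: "valid_forces G B ps" and c: "can_force G (B \<union> snd ` set ps) u w"
    using valid by (auto simp: fs valid_forces_append)
  \<comment> \<open>The forces in \<open>qs\<close> have been reversed by now, so exactly the
    sources in \<open>ps\<close> and \<open>u\<close> itself are still white.\<close>
  have blue: "terminus G (set fs) \<union> snd ` set xs = pverts G - insert u (fst ` set ps)"
  proof -
    have "fst ` set fs \<subseteq> pverts G" using force_in_pverts by auto
    then show ?thesis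
      using valid_forces_distinct(1)[OF valid] unfolding qs terminus_def by (auto simp: fs)
  qed
  have uw: "u \<in> pverts G" "w \<in> pverts G" using force_in_pverts[of u w] by (auto simp: fs)
  \<comment> \<open>Sources in \<open>ps\<close> were blue before \<open>u\<close> forced
    \<open>w\<close>, and so was \<open>u\<close>, whereas \<open>w\<close> was white.\<close>
  have "w \<notin> insert u (fst ` set ps)"
    using valid_forces_fst[OF vp] can_forceD(1,2)[OF c] by blast
  moreover have "y = u" if "w \<in> out_neighbors G y" "y \<in> insert u (fst ` set ps)" for y
    using that valid_forces_out_neighbors[OF vp, of y] can_forceD(2)[OF c] by blast
  moreover have "y \<in> pverts G" if "w \<in> out_neighbors G y" for y
  proof -
    interpret pair_digraph G by (rule pair_digraph)
    show ?thesis using that wellformed' by (auto simp: out_neighbors_def)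
  qed
  moreover have "w \<in> out_neighbors G u" using can_forceD(3)[OF c] .
  ultimately show "can_force (digraph_transpose G) (terminus G (set fs) \<union> snd ` set xs) w u"
    unfolding blue using uw by (auto simp: can_force_def out_neighbors_transpose)
qed

lemma reversed_is_set_of_forces:
  "is_set_of_forces (digraph_transpose G) (terminus G (set fs)) ((set fs)\<inverse>)"
proof -
  have "terminus G (set fs) \<union> snd ` ((set fs)\<inverse>) \<supseteq> pverts G"
    by (force simp: terminus_def)
  then have "\<not> can_force (digraph_transpose G) (terminus G (set fs) \<union> snd ` ((set fs)\<inverse>)) u w" for u w
    using can_force_in_pverts(1)[OF pair_digraph_transpose[OF pair_digraph]] can_forceD(2)
    by (metis pverts_transpose subsetD)
  moreover have "set (rev (map prod.swap fs)) = (set fs)\<inverse>" by force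
  ultimately show ?thesis
    unfolding is_set_of_forces_def using reversed_valid by blast
qed

text \<open>Some force in the set turned \<open>w\<close> blue, and injectivity leaves only the one
  from \<open>u\<close>.\<close>

lemma blue_at_forced_by:
  assumes "(u, w) \<in> set fs" "w \<in> blue_at G B (set fs) t"
  shows "\<exists>s < t. can_force G (blue_at G B (set fs) s) u w"
  using blue_at_forced[OF assms(2)] forced_not_initial[OF assms(1)] forces_injective[OF assms(1)]
  by blast

lemma reversed_blue_at:
  assumes "blue_at G B (set fs) t = pverts G" "s \<le> t"
  shows "pverts G - {u. \<exists>w. (u, w) \<in> set fs \<and> w \<in> blue_at G B (set fs) (t - s)}
    \<subseteq> blue_at (digraph_transpose G) (terminus G (set fs)) ((set fs)\<inverse>) s"
  using assms(2)
proof (induction s)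
  \<comment> \<open>At stage \<open>t\<close> every target is blue, so the excluded vertices are all
    the sources and the terminus remains.\<close>
  case 0
  then show ?case using assms(1) force_in_pverts by (force simp: terminus_def)
next
  case (Suc s)
  let ?blue = "blue_at G B (set fs)"
  let ?rblue = "blue_at (digraph_transpose G) (terminus G (set fs)) ((set fs)\<inverse>)"
  define r where "r = t - Suc s"
  have r: "t - s = Suc r" using Suc.prems by (simp add: r_def)
  have IH: "v \<in> ?rblue s" if "v \<in> pverts G" "\<And>x. (v, x) \<in> set fs \<Longrightarrow> x \<notin> ?blue (Suc r)" for v
    using Suc.IH Suc.prems that r by auto
  show ?case
  proof
    fix u assume "u \<in> pverts G - {u. \<exists>w. (u, w) \<in> set fs \<and> w \<in> ?blue (t - Suc s)}"
    then have u: "u \<in> pverts G" "\<And>w. (u, w) \<in> set fs \<Longrightarrow> w \<notin> ?blue r" by (auto simp: r_def)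
    show "u \<in> ?rblue (Suc s)"
    proof (cases "u \<in> ?rblue s")
      case False
      then obtain w where uw: "(u, w) \<in> set fs" "w \<in> ?blue (Suc r)" using IH u(1) by blast
      \<comment> \<open>A force performed by stage \<open>Suc r\<close> had its source, and all
        out-neighbors of the source but the target, blue by stage \<open>r\<close>.\<close>
      have early: "v \<in> ?blue r \<and> out_neighbors G v \<subseteq> insert x (?blue r)"
        if vx: "(v, x) \<in> set fs" "x \<in> ?blue (Suc r)" for v x
      proof -
        obtain q where "q < Suc r" "can_force G (?blue q) v x"
          using blue_at_forced_by[OF vx] by blast
        then show ?thesis using blue_at_mono[of q r G B "set fs"] by (auto simp: can_force_def)
      qed
      \<comment> \<open>Otherwise \<open>w\<close> would itself have forced by stage
        \<open>Suc r\<close>, hence been blue at stage \<open>r\<close>.\<close>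
      have "w \<in> ?rblue s"
        using IH[of w] force_in_pverts[OF uw(1)] early u(2)[OF uw(1)] by blast
      \<comment> \<open>A white \<open>y\<close> has forced some \<open>x\<close> by stage
        \<open>Suc r\<close>; as \<open>w\<close> is white at stage \<open>r\<close>, it can only be
        that \<open>x\<close>.\<close>
      moreover have "y = u" if y: "w \<in> out_neighbors G y" "y \<notin> ?rblue s" for y
      proof -
        interpret pair_digraph G by (rule pair_digraph)
        have "y \<in> pverts G" using y(1) wellformed' by (auto simp: out_neighbors_def)
        then obtain x where yx: "(y, x) \<in> set fs" "x \<in> ?blue (Suc r)" using IH y(2) by blast
        then have "w = x" using early y(1) u(2)[OF uw(1)] by blast
        then show "y = u" using forces_injective uw(1) yx(1) by blast
      qed
      moreover have "w \<in> out_neighbors G u"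
        using blue_at_forced_by[OF uw] can_forceD(3)[of G _ u w] by blast
      ultimately have "can_force (digraph_transpose G) (?rblue s) w u"
        using False unfolding can_force_def out_neighbors_transpose by blast
      then show ?thesis using uw(1) by auto
    qed simp
  qed
qed

lemma reversed_pt_le:
  assumes "blue_at G B (set fs) t = pverts G"
  shows "pt_forces (digraph_transpose G) (terminus G (set fs)) ((set fs)\<inverse>) \<le> enat t"
proof -
  let ?rblue = "blue_at (digraph_transpose G) (terminus G (set fs)) ((set fs)\<inverse>)"
  have "?rblue t \<subseteq> pverts G"
    using blue_at_subset[of "digraph_transpose G" "terminus G (set fs)" "(set fs)\<inverse>" t] force_in_pverts
    by (auto simp: terminus_def)
  \<comment> \<open>For \<open>s = t\<close> the stage \<open>t - s\<close> is 0, where only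
    \<open>B\<close> is blue; no target lies in \<open>B\<close>, so nothing is excluded.\<close>
  moreover have "pverts G \<subseteq> ?rblue t"
    using reversed_blue_at[OF assms order_refl] forced_not_initial by auto
  ultimately have "?rblue t = pverts (digraph_transpose G)" by simp
  then show ?thesis unfolding pt_forces_def by (simp add: Least_le exI[of _ t])
qed

end

section \<open>Comparison of throttling numbers\<close>

lemma throttling_number_transpose_le:
  assumes "pair_digraph G"
  shows "throttling_number (digraph_transpose G) \<le> throttling_number G"
proof -
  obtain B where B: "B \<subseteq> pverts G" "throttling_number G = enat (card B) + pt_set G B"
    using throttling_number_attained[of G] by blast
  obtain F where F: "is_set_of_forces G B F" "pt_set G B = pt_forces G B F"
    using pt_set_attained[OF assms B(1)] by blast
  show ?thesis
  proof (cases "\<exists>t. blue_at G B F t = pverts G")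
    case True
    define t where "t = (LEAST t. blue_at G B F t = pverts G)"
    have t: "blue_at G B F t = pverts G" unfolding t_def using True by (rule LeastI_ex)
    obtain fs where fs: "set fs = F" "valid_forces G B fs"
      using F(1) by (auto simp: is_set_of_forces_def)
    \<comment> \<open>Covering holds because the vertices blue at stage \<open>t\<close>, which are
      all vertices, are initial or targets.\<close>
    interpret forcing_process G B fs
      using assms B(1) fs blue_at_subset[of G B F t] t by (intro forcing_process.intro) simp_all
    let ?H = "digraph_transpose G"
    have "throttling_number ?H \<le> enat (card (terminus G F)) + pt_set ?H (terminus G F)"
      unfolding throttling_number_def by (rule INF_lower) (simp add: terminus_def)
    also have "\<dots> \<le> enat (card (terminus G F)) + pt_forces ?H (terminus G F) (F\<inverse>)"
      unfolding pt_set_def using reversed_is_set_of_forces fs(1)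
      by (intro add_left_mono INF_lower) simp
    also have "\<dots> \<le> enat (card B) + enat t"
      using card_terminus reversed_pt_le[of t] t unfolding fs(1) by (metis add_left_mono)
    also have "\<dots> = throttling_number G"
      using True by (simp add: B(2) F(2) pt_forces_def t_def)
    finally show ?thesis .
  \<comment> \<open>If \<open>F\<close> never turns everything blue, the right-hand side is
    \<infinity>.\<close>
  qed (simp add: B(2) F(2) pt_forces_def)
qed

theorem theorem2p13:
  fixes \<Gamma> :: "'a pair_pre_digraph"
  assumes "pair_digraph \<Gamma>"
  shows "throttling_number \<Gamma> = throttling_number (digraph_transpose \<Gamma>)"
  using throttling_number_transpose_le[OF assms]
    throttling_number_transpose_le[OF pair_digraph_transpose[OF assms]]
  by simp

end
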